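(* Let $G$ be a finite non-nilpotent group and let $\mathcal U$ be the set of the nontrivial strongly self-centralizing subgroups of $G$; assume $\mathcal U\neq\emptyset$. If $U\in\mathcal U$, then $U-\{1\}$ is the set of vertices of a connected component of $\Gamma_{\mathfrak N}(G)$, and $$\kappa(\Gamma_{\mathfrak N}(G))\geq\begin{cases}|\mathcal U| & \text{if }\bigcup_{U\in\mathcal U}U=G,\\ |\mathcal U|+1 & \text{if }\bigcup_{U\in\mathcal U}U\neq G.\end{cases}$$
   Context: A subgroup $U$ of $G$ is strongly self-centralizing if $C_G(x)=U$ for all $1\ne x\in U$. For a finite group $G$, $\mathrm{nil}(G)=\{g\in G:\langle g,h\rangle \text{ is nilpotent for all } h\in G\}$. For a finite non-nilpotent group $G$, the nilpotent graph $\Gamma_{\mathfrak N}(G)$ is the simple undirected graph with vertex set $G-\mathrm{nil}(G)$ (set difference) in which two distinct vertices $g,h$ are adjacent if and only if $\langle g,h\rangle$ is nilpotent. $\kappa(\Gamma)$ denotes the number of connected components of a graph $\Gamma$. *)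

theory Defs
  imports "HOL-Algebra.Elementary_Groups" "Graph_Theory.Digraph_Component"
begin

section \<open>Nilpotent groups\<close>

definition commutator_subgroup :: "('a, 'b) monoid_scheme \<Rightarrow> 'a set \<Rightarrow> 'a set \<Rightarrow> 'a set" where
  "commutator_subgroup G A B =
     generate G {a \<otimes>\<^bsub>G\<^esub> b \<otimes>\<^bsub>G\<^esub> inv\<^bsub>G\<^esub> a \<otimes>\<^bsub>G\<^esub> inv\<^bsub>G\<^esub> b | a b. a \<in> A \<and> b \<in> B}"

primrec lower_central_series :: "('a, 'b) monoid_scheme \<Rightarrow> nat \<Rightarrow> 'a set" where
  "lower_central_series G 0 = carrier G"
| "lower_central_series G (Suc n) =
     commutator_subgroup G (lower_central_series G n) (carrier G)"

definition nilpotent_group :: "('a, 'b) monoid_scheme \<Rightarrow> bool" where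
  "nilpotent_group G \<longleftrightarrow> group G \<and> (\<exists>n. lower_central_series G n = {\<one>\<^bsub>G\<^esub>})"


section \<open>Strongly self-centralizing subgroups\<close>

definition elt_centralizer :: "('a, 'b) monoid_scheme \<Rightarrow> 'a \<Rightarrow> 'a set" where
  "elt_centralizer G x = {g \<in> carrier G. g \<otimes>\<^bsub>G\<^esub> x = x \<otimes>\<^bsub>G\<^esub> g}"

definition strongly_self_centralizing :: "('a, 'b) monoid_scheme \<Rightarrow> 'a set \<Rightarrow> bool" where
  "strongly_self_centralizing G U \<longleftrightarrow>
     subgroup U G \<and> (\<forall>x\<in>U. x \<noteq> \<one>\<^bsub>G\<^esub> \<longrightarrow> elt_centralizer G x = U)"

definition nontrivial_ssc_subgroups :: "('a, 'b) monoid_scheme \<Rightarrow> 'a set set" where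
  "nontrivial_ssc_subgroups G = {U. strongly_self_centralizing G U \<and> U \<noteq> {\<one>\<^bsub>G\<^esub>}}"


section \<open>The nilpotent graph\<close>

definition nil_set :: "('a, 'b) monoid_scheme \<Rightarrow> 'a set" where
  "nil_set G =
     {g \<in> carrier G. \<forall>h\<in>carrier G. nilpotent_group (subgroup_generated G {g, h})}"

text \<open>
  An undirected simple graph is represented by a loop-free digraph in which every edge
  occurs in both directions (locale \<open>pair_graph\<close> in the finite case).
\<close>

definition nilpotent_graph :: "('a, 'b) monoid_scheme \<Rightarrow> 'a pair_pre_digraph" where
  "nilpotent_graph G =
     \<lparr> pverts = carrier G - nil_set G,
       parcs = {(g, h). g \<in> carrier G - nil_set G \<and> h \<in> carrier G - nil_set G \<and> g \<noteq> h \<and>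
                  nilpotent_group (subgroup_generated G {g, h})} \<rparr>"

lemma pair_graph_nilpotent_graph:
  assumes "finite (carrier G)"
  shows "pair_graph (nilpotent_graph G)"
proof -
  have "parcs (nilpotent_graph G) \<subseteq> carrier G \<times> carrier G"
    by (auto simp: nilpotent_graph_def)
  then have "finite (parcs (nilpotent_graph G))"
    using assms by (meson finite_SigmaI finite_subset)
  then show ?thesis
    using assms
    by unfold_locales
      (auto simp: nilpotent_graph_def symmetric_def insert_commute intro!: symI)
qed


section \<open>Connected components\<close>

text \<open>
  A connected component is a maximal connected subgraph. The library's \<open>connected\<close>
  excludes the empty graph, so components are nonempty and the graph without
  vertices has none.
\<close>

definition components :: "'a pair_pre_digraph \<Rightarrow> ('a, 'a \<times> 'a) pre_digraph set" where
  "components \<Gamma> =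
     {C. pre_digraph.max_subgraph (with_proj \<Gamma>) Digraph_Component.connected C}"

definition num_components :: "'a pair_pre_digraph \<Rightarrow> nat" where
  "num_components \<Gamma> = card (components \<Gamma>)"

end

theory Submission
  imports Defs
begin

text \<open>
  Let \<open>U\<close> be strongly self-centralizing and \<open>1 \<noteq> x \<in> U\<close>. If \<open>\<langle>x, h\<rangle>\<close> is nilpotent, it is a
  nontrivial nilpotent group and so has a central element \<open>z \<noteq> 1\<close>. Since \<open>z\<close> commutes with \<open>x\<close>,
  it lies in \<open>C(x) = U\<close>; since \<open>h\<close> commutes with \<open>z\<close>, it lies in \<open>C(z) = U\<close>
  (\<open>ssc_nilpotent_pair_closed\<close>). So no edge leaves \<open>U - {1}\<close>. Conversely \<open>U\<close> is abelian, so
  any two elements of \<open>U\<close> generate an abelian, hence nilpotent, group, and \<open>U - {1}\<close> is a clique.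

  The same closure property controls the vertex set. An element of \<open>nil(G)\<close> forms a nilpotent pair
  with every element of \<open>U - {1}\<close>, so \<open>nil(G) \<subseteq> U\<close>; and if \<open>nil(G)\<close> met \<open>U - {1}\<close>, then all of
  \<open>G\<close> would lie in the abelian group \<open>U\<close>, contradicting non-nilpotency. So \<open>U - {1}\<close> consists of
  vertices and is a connected component, distinct \<open>U\<close> give distinct components, and an element of
  \<open>G\<close> outside every \<open>U\<close> is a vertex lying in a further component.
\<close>

section \<open>Nilpotent groups\<close>

lemma (in comm_group) nilpotent_group: "nilpotent_group G"
proof -
  have "{a \<otimes> b \<otimes> inv a \<otimes> inv b | a b. a \<in> carrier G \<and> b \<in> carrier G} \<subseteq> {\<one>}"
  proof clarify
    fix a b assume a: "a \<in> carrier G" and b: "b \<in> carrier G"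
    then have "a \<otimes> b \<otimes> inv a \<otimes> inv b = b \<otimes> (a \<otimes> inv a) \<otimes> inv b"
      by (simp add: m_assoc m_comm[of a b] del: r_inv)
    then show "a \<otimes> b \<otimes> inv a \<otimes> inv b = \<one>" using a b by simp
  qed
  then have "generate G {a \<otimes> b \<otimes> inv a \<otimes> inv b | a b. a \<in> carrier G \<and> b \<in> carrier G} \<subseteq> {\<one>}"
    by (intro generate_subgroup_incl triv_subgroup)
  then have "lower_central_series G (Suc 0) = {\<one>}"
    using generate.one[of G] by (auto simp: commutator_subgroup_def)
  then show ?thesis unfolding nilpotent_group_def using is_group by blast
qed

context group
begin

lemma one_in_lower_central_series: "\<one> \<in> lower_central_series G n"
  by (cases n) (simp_all add: commutator_subgroup_def generate.one)

lemma lower_central_series_subset: "lower_central_series G n \<subseteq> carrier G"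
proof (induction n)
  case (Suc n)
  have "{a \<otimes> b \<otimes> inv a \<otimes> inv b | a b. a \<in> lower_central_series G n \<and> b \<in> carrier G} \<subseteq> carrier G"
    using Suc.IH by auto
  then show ?case by (simp add: commutator_subgroup_def generate_incl)
qed simp

text \<open>The last nontrivial term of the lower central series is central.\<close>

lemma nilpotent_nontrivial_center:
  assumes "nilpotent_group G" and "carrier G \<noteq> {\<one>}"
  obtains z where "z \<in> carrier G" "z \<noteq> \<one>" "\<And>g. g \<in> carrier G \<Longrightarrow> z \<otimes> g = g \<otimes> z"
proof -
  define n where "n = (LEAST n. lower_central_series G n = {\<one>})"
  have n: "lower_central_series G n = {\<one>}"
    using assms(1) unfolding nilpotent_group_def n_def by (metis (mono_tags, lifting) LeastI)
  then have "n \<noteq> 0" using assms(2) by (cases n) auto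
  then obtain m where m: "n = Suc m" by (cases n) auto
  then have "lower_central_series G m \<noteq> {\<one>}"
    using not_less_Least[of m "\<lambda>n. lower_central_series G n = {\<one>}"] by (simp add: n_def[symmetric])
  then obtain z where z: "z \<in> lower_central_series G m" "z \<noteq> \<one>"
    using one_in_lower_central_series[of m] by blast
  have zc: "z \<in> carrier G" using z lower_central_series_subset by blast
  have "z \<otimes> g = g \<otimes> z" if g: "g \<in> carrier G" for g
  proof -
    have "z \<otimes> g \<otimes> inv z \<otimes> inv g \<in> lower_central_series G n"
      unfolding m lower_central_series.simps commutator_subgroup_def
      using z(1) g by (intro generate.incl) blast
    then have "(z \<otimes> g) \<otimes> inv (g \<otimes> z) = \<one>"
      using zc g by (simp add: n inv_mult_group m_assoc)
    then show ?thesis using inv_solve_right[of \<one> "z \<otimes> g" "g \<otimes> z"] zc g by simp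
  qed
  then show thesis using that zc z(2) by blast
qed

end


section \<open>Strongly self-centralizing subgroups\<close>

context group
begin

lemma ssc_commute:
  assumes "strongly_self_centralizing G U" "x \<in> U" "y \<in> U"
  shows "x \<otimes> y = y \<otimes> x"
proof (cases "y = \<one>")
  case True
  have "subgroup U G" using assms(1) by (simp add: strongly_self_centralizing_def)
  then have "x \<in> carrier G" using assms(2) by (rule subgroup.mem_carrier)
  then show ?thesis using True by simp
next
  case False
  then have "x \<in> elt_centralizer G y"
    using assms by (simp add: strongly_self_centralizing_def)
  then show ?thesis by (simp add: elt_centralizer_def)
qed

lemma ssc_nilpotent_pair:
  assumes U: "strongly_self_centralizing G U" and xy: "x \<in> U" "y \<in> U"
  shows "nilpotent_group (subgroup_generated G {x, y})"
proof -
  have "subgroup U G" using U by (simp add: strongly_self_centralizing_def)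
  then have sub: "carrier (subgroup_generated G {x, y}) \<subseteq> U"
    by (rule subgroup_generated_minimal) (use xy in auto)
  have "comm_group (subgroup_generated G {x, y})"
    by (rule group.group_comm_groupI) (use sub ssc_commute[OF U] in auto)
  then show ?thesis by (rule comm_group.nilpotent_group)
qed

text \<open>
  The centre of \<open>\<langle>x, h\<rangle>\<close> supplies the link from \<open>x\<close> to \<open>h\<close>: a nontrivial central element commutes
  with both.
\<close>

lemma ssc_nilpotent_pair_closed:
  assumes U: "strongly_self_centralizing G U" and x: "x \<in> U" "x \<noteq> \<one>" and h: "h \<in> carrier G"
    and nil: "nilpotent_group (subgroup_generated G {x, h})"
  shows "h \<in> U"
proof -
  let ?H = "subgroup_generated G {x, h}"
  have "subgroup U G" using U by (simp add: strongly_self_centralizing_def)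
  then have "x \<in> carrier G" using x(1) by (rule subgroup.mem_carrier)
  then have xh: "x \<in> carrier ?H" "h \<in> carrier ?H"
    using subgroup_generated_subset_carrier_subset[of "{x, h}"] h by auto
  interpret H: group ?H by simp
  have "carrier ?H \<noteq> {\<one>\<^bsub>?H\<^esub>}" using xh(1) x(2) by auto
  from H.nilpotent_nontrivial_center[OF nil this] obtain z
    where z: "z \<in> carrier ?H" "z \<noteq> \<one>" "\<And>g. g \<in> carrier ?H \<Longrightarrow> z \<otimes> g = g \<otimes> z"
    by auto
  have zG: "z \<in> carrier G" using z(1) carrier_subgroup_generated_subset by blast
  have "z \<in> elt_centralizer G x"
    using zG z(3)[OF xh(1)] by (simp add: elt_centralizer_def)
  then have zU: "z \<in> U" using U x by (simp add: strongly_self_centralizing_def)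
  have "h \<in> elt_centralizer G z"
    using h z(3)[OF xh(2)] by (simp add: elt_centralizer_def)
  then show ?thesis using U zU z(2) by (simp add: strongly_self_centralizing_def)
qed

text \<open>
  The reason is that \<open>\<langle>1, h\<rangle>\<close> is cyclic. Hence \<open>1\<close> is not a vertex, and a neighbour in \<open>U\<close> of a
  vertex lies in \<open>U - {1}\<close>.
\<close>

lemma one_in_nil_set: "\<one> \<in> nil_set G"
proof -
  have "nilpotent_group (subgroup_generated G {\<one>, h})" if "h \<in> carrier G" for h
  proof -
    let ?C = "subgroup_generated G {h}"
    have sub: "subgroup (carrier ?C) G" by (rule subgroup_subgroup_generated)
    have "h \<in> carrier ?C" using subgroup_generated_subset_carrier_subset[of "{h}"] that by simp
    then have "carrier (subgroup_generated G {\<one>, h}) \<subseteq> carrier ?C"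
      using subgroup_generated_minimal[OF sub] subgroup.one_closed[OF sub] by simp
    moreover have "comm_group ?C"
      using group.cyclic_imp_abelian_group[OF group_subgroup_generated] cyclic_group_generated by blast
    ultimately have "comm_group (subgroup_generated G {\<one>, h})"
      by (intro group.group_comm_groupI) (use comm_groupE(4)[of ?C] in auto)
    then show ?thesis by (rule comm_group.nilpotent_group)
  qed
  then show ?thesis by (simp add: nil_set_def)
qed

text \<open>
  If \<open>x \<in> nil(G)\<close>, every element of \<open>G\<close> forms a nilpotent pair with \<open>x\<close>, so \<open>U = G\<close> and \<open>G\<close> is
  abelian.
\<close>

lemma ssc_disjoint_nil_set:
  assumes "\<not> nilpotent_group G" and U: "strongly_self_centralizing G U" and x: "x \<in> U" "x \<noteq> \<one>"
  shows "x \<notin> nil_set G"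
proof
  assume "x \<in> nil_set G"
  then have "carrier G \<subseteq> U"
    using ssc_nilpotent_pair_closed[OF U x] by (auto simp: nil_set_def)
  then have "comm_group G"
    using ssc_commute[OF U] by (intro group_comm_groupI) auto
  then show False using comm_group.nilpotent_group assms(1) by blast
qed

text \<open>
  This places every element outside \<open>U\<close> among the vertices of the nilpotent graph.
\<close>

lemma nil_set_subset_ssc:
  assumes U: "strongly_self_centralizing G U" and x: "x \<in> U" "x \<noteq> \<one>"
  shows "nil_set G \<subseteq> U"
proof
  fix g assume g: "g \<in> nil_set G"
  have "subgroup U G" using U by (simp add: strongly_self_centralizing_def)
  then have "x \<in> carrier G" using x(1) by (rule subgroup.mem_carrier)
  then have "nilpotent_group (subgroup_generated G {x, g})"
    using g by (auto simp: nil_set_def insert_commute)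
  then show "g \<in> U" using ssc_nilpotent_pair_closed[OF U x] g by (auto simp: nil_set_def)
qed

lemma nontrivial_ssc_subgroupE:
  assumes "U \<in> nontrivial_ssc_subgroups G"
  obtains x where "strongly_self_centralizing G U" "\<one> \<in> U" "U \<subseteq> carrier G" "x \<in> U" "x \<noteq> \<one>"
proof -
  have ssc: "strongly_self_centralizing G U" and "U \<noteq> {\<one>}"
    using assms by (auto simp: nontrivial_ssc_subgroups_def)
  moreover have "subgroup U G" using ssc by (simp add: strongly_self_centralizing_def)
  then have "\<one> \<in> U" "U \<subseteq> carrier G" by (simp_all add: subgroup.one_closed subgroup.subset)
  ultimately show thesis using that by blast
qed

end


section \<open>Components of symmetric graphs\<close>

text \<open>
  A maximal connected subgraph is induced, and an induced subgraph of a symmetric graph is symmetric,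
  so that connectedness and strong connectedness agree on it.
\<close>

lemma components_eq_sccs:
  fixes \<Gamma> :: "'a pair_pre_digraph"
  assumes "pair_graph \<Gamma>"
  shows "components \<Gamma> = pre_digraph.sccs (with_proj \<Gamma>)"
proof -
  interpret pair_graph \<Gamma> by fact
  have strong: "strongly_connected H" if "induced_subgraph H (with_proj \<Gamma>)" "connected H" for H
  proof -
    interpret H: sym_digraph H using that(1) by (rule induced_graph_imp_graph)
    show ?thesis using H.sym_arcs that(2) by (rule H.symmetric_connected_imp_strongly_connected)
  qed
  have weak: "connected H" if "subgraph H (with_proj \<Gamma>)" "strongly_connected H" for H
  proof -
    interpret H: wf_digraph H using that(1) by auto
    show ?thesis
      using that(2) H.reachable_mk_symmetricI by (auto simp: connected_def strongly_connected_def)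
  qed
  have spanning_mono: "arc_mono (Digraph_Component.connected :: ('a, 'a \<times> 'a) pre_digraph \<Rightarrow> bool)"
    unfolding arc_mono_def
  proof (intro allI impI, elim conjE)
    fix H1 H2 :: "('a, 'a \<times> 'a) pre_digraph"
    assume "connected H1" "subgraph H1 H2" "verts H1 = verts H2"
    then show "connected H2"
      by (intro wf_digraph.connected_spanning_imp_connected[of H2 H1]) (auto simp: spanning_def)
  qed
  have "max_subgraph Digraph_Component.connected H \<longleftrightarrow> max_subgraph strongly_connected H" for H
  proof
    assume H: "max_subgraph Digraph_Component.connected H"
    then have "strongly_connected H"
      using strong induced_subgraphI_arc_mono[OF H spanning_mono] max_subgraph_prop by blast
    then show "max_subgraph strongly_connected H"
      using H weak by (auto simp: max_subgraph_def)
  next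
    assume H: "max_subgraph strongly_connected H"
    then have HG: "subgraph H (with_proj \<Gamma>)" by (rule subgraphI_max_subgraph)
    show "max_subgraph Digraph_Component.connected H"
    proof (rule max_subgraphI)
      show "connected H" using weak HG H max_subgraph_prop by blast
      show "subgraph H (with_proj \<Gamma>)" by fact
      fix K assume K: "H \<noteq> K" "subgraph H K" "subgraph K (with_proj \<Gamma>)"
      \<comment> \<open>\<open>K\<close> itself need not be symmetric, so strong connectedness is only available for the
        subgraph induced on its vertices.\<close>
      let ?K = "with_proj \<Gamma> \<restriction> verts K"
      show "\<not> connected K"
      proof
        assume conn: "connected K"
        have ind: "induced_subgraph ?K (with_proj \<Gamma>)"
          using K(3) by (intro induced_induce) (auto simp: subgraph_def)
        have KK: "subgraph K ?K" using K(3) by (rule subgraph_induce_subgraphI2)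
        have "connected ?K"
          using spanning_mono conn KK unfolding arc_mono_def by (metis induce_subgraph_verts)
        then have "strongly_connected ?K" using strong ind by blast
        moreover have "subgraph H ?K" using K(2) KK by (rule subgraph_trans)
        ultimately have "?K = H" using H induced_imp_subgraph[OF ind] by (auto simp: max_subgraph_def)
        then have "K = H" using K(2) KK by (auto simp: subgraph_def compatible_def)
        then show False using K(1) by simp
      qed
    qed
  qed
  then show ?thesis by (simp add: components_def sccs_altdef2)
qed

lemma clique_in_sccs_verts:
  assumes "pair_graph \<Gamma>" and "S \<noteq> {}" and "S \<subseteq> pverts \<Gamma>"
    and clique: "\<And>x y. x \<in> S \<Longrightarrow> y \<in> S \<Longrightarrow> x \<noteq> y \<Longrightarrow> (x, y) \<in> parcs \<Gamma>"
    and closed: "\<And>x y. x \<in> S \<Longrightarrow> (x, y) \<in> parcs \<Gamma> \<Longrightarrow> y \<in> S"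
  shows "S \<in> pre_digraph.sccs_verts (with_proj \<Gamma>)"
proof -
  interpret pair_graph \<Gamma> by fact
  have "v \<in> S" if "u \<rightarrow>\<^sup>*\<^bsub>with_proj \<Gamma>\<^esub> v" "u \<in> S" for u v
    using that by (induction rule: reachable_induct) (auto intro: closed)
  moreover have "u \<rightarrow>\<^sup>*\<^bsub>with_proj \<Gamma>\<^esub> v" if "u \<in> S" "v \<in> S" for u v
    using that clique[of u v] assms(3) by (cases "u = v") auto
  ultimately show ?thesis
    using assms(2) unfolding in_sccs_verts_conv_reachable by blast
qed

lemma (in group) ssc_in_sccs_verts:
  assumes "finite (carrier G)" and "\<not> nilpotent_group G" and "U \<in> nontrivial_ssc_subgroups G"
  shows "U - {\<one>} \<in> pre_digraph.sccs_verts (with_proj (nilpotent_graph G))"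
proof -
  obtain x where U: "strongly_self_centralizing G U" "U \<subseteq> carrier G" and x: "x \<in> U" "x \<noteq> \<one>"
    using assms(3) by (elim nontrivial_ssc_subgroupE)
  have one: "\<one> \<in> nil_set G" by (rule one_in_nil_set)
  have V: "U - {\<one>} \<subseteq> pverts (nilpotent_graph G)"
    using U ssc_disjoint_nil_set[OF assms(2) U(1)] by (auto simp: nilpotent_graph_def)
  show ?thesis
  proof (rule clique_in_sccs_verts)
    show "pair_graph (nilpotent_graph G)" by (rule pair_graph_nilpotent_graph) fact
    show "U - {\<one>} \<noteq> {}" using x by blast
    show "U - {\<one>} \<subseteq> pverts (nilpotent_graph G)" by fact
    show "(x, y) \<in> parcs (nilpotent_graph G)" if "x \<in> U - {\<one>}" "y \<in> U - {\<one>}" "x \<noteq> y" for x y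
      using that V ssc_nilpotent_pair[OF U(1)] by (auto simp: nilpotent_graph_def)
    show "y \<in> U - {\<one>}" if "x \<in> U - {\<one>}" "(x, y) \<in> parcs (nilpotent_graph G)" for x y
      using that one ssc_nilpotent_pair_closed[OF U(1)] by (auto simp: nilpotent_graph_def)
  qed
qed


section \<open>Counting the components\<close>

theorem theorem3p3:
  fixes G :: "('a, 'b) monoid_scheme"
  assumes "group G"
    and "finite (carrier G)"
    and "\<not> nilpotent_group G"
    and "nontrivial_ssc_subgroups G \<noteq> {}"
  shows "(\<forall>U \<in> nontrivial_ssc_subgroups G.
            \<exists>C \<in> components (nilpotent_graph G). verts C = U - {\<one>\<^bsub>G\<^esub>}) \<and>
         num_components (nilpotent_graph G) \<ge>
           (if \<Union> (nontrivial_ssc_subgroups G) = carrier G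
            then card (nontrivial_ssc_subgroups G)
            else card (nontrivial_ssc_subgroups G) + 1)"
proof -
  interpret group G by fact
  let ?U = "nontrivial_ssc_subgroups G"
  interpret \<Gamma>: pair_graph "nilpotent_graph G"
    by (rule pair_graph_nilpotent_graph) fact
  let ?verts = "(\<lambda>U. U - {\<one>\<^bsub>G\<^esub>}) ` ?U"
  have comps: "components (nilpotent_graph G) = \<Gamma>.sccs"
    by (rule components_eq_sccs) unfold_locales
  have verts: "?verts \<subseteq> \<Gamma>.sccs_verts"
    using ssc_in_sccs_verts[OF assms(2,3)] by blast
  have inj: "inj_on (\<lambda>U. U - {\<one>\<^bsub>G\<^esub>}) ?U"
    by (rule inj_onI) (metis insert_Diff nontrivial_ssc_subgroupE)
  have num: "num_components (nilpotent_graph G) = card \<Gamma>.sccs_verts"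
    by (simp add: num_components_def comps \<Gamma>.card_sccs_verts)
  have le: "card ?U \<le> card \<Gamma>.sccs_verts"
    using card_mono[OF \<Gamma>.finite_sccs_verts verts] card_image[OF inj] by simp
  have less: "card ?U < card \<Gamma>.sccs_verts" if "\<Union> ?U \<noteq> carrier G"
  proof -
    have "\<Union> ?U \<subseteq> carrier G"
      by (auto elim!: nontrivial_ssc_subgroupE)
    with that obtain g where g: "g \<in> carrier G" "g \<notin> \<Union> ?U" by blast
    obtain U where U: "U \<in> ?U" using assms(4) by blast
    have "nil_set G \<subseteq> U"
      using U by (elim nontrivial_ssc_subgroupE) (rule nil_set_subset_ssc)
    then have "g \<in> pverts (nilpotent_graph G)"
      using g U by (auto simp: nilpotent_graph_def)
    then have "\<Gamma>.scc_of g \<in> \<Gamma>.sccs_verts" "g \<in> \<Gamma>.scc_of g"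
      using \<Gamma>.scc_of_in_sccs_verts \<Gamma>.in_scc_of_self by blast+
    then have "?verts \<subset> \<Gamma>.sccs_verts" using verts g(2) by blast
    then show ?thesis
      using psubset_card_mono[OF \<Gamma>.finite_sccs_verts] card_image[OF inj] by metis
  qed
  have "\<exists>C \<in> components (nilpotent_graph G). verts C = U - {\<one>\<^bsub>G\<^esub>}" if "U \<in> ?U" for U
  proof -
    have "U - {\<one>\<^bsub>G\<^esub>} \<in> verts ` \<Gamma>.sccs"
      using that verts unfolding \<Gamma>.sccs_verts_conv by blast
    then show ?thesis by (auto simp: comps)
  qed
  then show ?thesis using le less num by (simp add: Suc_le_eq)
qed

end
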